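(* Let $\lambda\ge 0$, $t\in\left(\frac{\sqrt2}{2},1\right]$, $\mu\in\mathbb{R}$, and let $f(z)=z+\sum_{n=2}^{\infty}a_nz^n$ belong to the class $H_\Sigma(\lambda,t)$. Then: (i) if $|\mu-1|\le \dfrac{1}{8(1+2\lambda)}\left|\dfrac{(1+\lambda)^2}{t^2}-4\lambda(1+\lambda)\right|$, then $$|a_3-\mu a_2^2|\le \frac{t}{1+2\lambda};$$ (ii) if $|\mu-1|\ge \dfrac{1}{8(1+2\lambda)}\left|\dfrac{(1+\lambda)^2}{t^2}-4\lambda(1+\lambda)\right|$, then $$|a_3-\mu a_2^2|\le \frac{8|1-\mu|t^3}{\left|4(1+\lambda)t^2-(1+\lambda)^2(4t^2-1)\right|}.$$
   Context: Let $D=\{z\in\mathbb{C}:|z|<1\}$. $A$ is the class of functions $f$ analytic in $D$ with $f(0)=0$, $f'(0)=1$, so $f(z)=z+\sum_{n=2}^\infty a_nz^n$. A function $f\in A$ is bi-univalent in $D$ if both $f$ and $f^{-1}$ are univalent in $D$. Here $f^{-1}$ is the inverse of $f$, defined a priori on a disk $|w|<r_0(f)$ with $r_0(f)\ge 1/4$; for $f$ bi-univalent, $f^{-1}$ is understood as its univalent analytic continuation to all of $D$. $\Sigma$ denotes the class of bi-univalent functions. Near $0$, $f^{-1}(w)=w-a_2w^2+(2a_2^2-a_3)w^3-\cdots$. For $F,G$ analytic in $D$, $F$ is subordinate to $G$, written $F\prec G$, if there is an analytic function $\omega$ on $D$ with $\omega(0)=0$ and $|\omega(z)|<1$ for $z\in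 D$ such that $F(z)=G(\omega(z))$ for all $z\in D$. For $\lambda\ge 0$ and $t\in\left(\frac{\sqrt2}{2},1\right]$, the class $H_\Sigma(\lambda,t)$ consists of all $f\in\Sigma$ such that, with $g=f^{-1}$ and $H(z,t)=\frac{1}{1-2tz+z^2}$, $$(1-\lambda)\frac{zf'(z)}{f(z)}+\lambda\left(1+\frac{zf''(z)}{f'(z)}\right)\prec H(z,t)\quad(z\in D)$$ and $$(1-\lambda)\frac{wg'(w)}{g(w)}+\lambda\left(1+\frac{wg''(w)}{g'(w)}\right)\prec H(w,t)\quad(w\in D),$$ where $\frac{zf'(z)}{f(z)}$ and $\frac{wg'(w)}{g(w)}$ are given the value $1$ at the origin (removable singularity).
   Formalization: Part (ii) is stated only when the denominator 4(1+λ)t²−(1+λ)²(4t²−1) is nonzero; it vanishes for some admissible parameters (e.g. λ=1/3, t=1), where the printed bound is undefined. *)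

theory Defs
  imports "HOL-Complex_Analysis.Complex_Analysis"
begin

text \<open>
  Functions on the open unit disc are total functions on the complex plane of which only the
  values on \<open>ball 0 1\<close> matter.
\<close>

definition normalized_class :: "(complex \<Rightarrow> complex) set" where
  "normalized_class = {f. f holomorphic_on ball 0 1 \<and> f 0 = 0 \<and> deriv f 0 = 1}"

text \<open>
  The inverse of \<open>f\<close> is a priori given on some disc about 0 contained in the image of \<open>f\<close>, and
  \<open>g\<close> is its analytic continuation to the unit disc. By the identity theorem the values of
  \<open>g\<close> on the unit disc do not depend on the choice of the radius \<open>r\<close>.
\<close>

definition inverse_continuation :: "(complex \<Rightarrow> complex) \<Rightarrow> (complex \<Rightarrow> complex) \<Rightarrow> bool" where
  "inverse_continuation f g \<longleftrightarrow>
     g holomorphic_on ball 0 1 \<and>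
     (\<exists>r>0. ball 0 r \<subseteq> f ` ball 0 1 \<and> (\<forall>w\<in>ball 0 r. g w = inv_into (ball 0 1) f w))"

definition bi_univalent_inverse :: "(complex \<Rightarrow> complex) \<Rightarrow> (complex \<Rightarrow> complex) \<Rightarrow> bool" where
  "bi_univalent_inverse f g \<longleftrightarrow>
     inj_on f (ball 0 1) \<and> inverse_continuation f g \<and> inj_on g (ball 0 1)"

definition bi_univalent_class :: "(complex \<Rightarrow> complex) set" where
  "bi_univalent_class = {f \<in> normalized_class. \<exists>g. bi_univalent_inverse f g}"

definition subordinate :: "(complex \<Rightarrow> complex) \<Rightarrow> (complex \<Rightarrow> complex) \<Rightarrow> bool"
    (infix \<open>\<prec>\<^sub>D\<close> 50) where
  "F \<prec>\<^sub>D G \<longleftrightarrow>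
     (\<exists>\<omega>. \<omega> holomorphic_on ball 0 1 \<and> \<omega> 0 = 0 \<and> (\<forall>z\<in>ball 0 1. norm (\<omega> z) < 1) \<and>
          (\<forall>z\<in>ball 0 1. F z = G (\<omega> z)))"

definition chebyshev_gen :: "real \<Rightarrow> complex \<Rightarrow> complex" where
  "chebyshev_gen t z = 1 / (1 - 2 * of_real t * z + z\<^sup>2)"

text \<open>The first quotient has a removable singularity at 0, where its value is 1.\<close>

definition starlike_convex_mean :: "real \<Rightarrow> (complex \<Rightarrow> complex) \<Rightarrow> complex \<Rightarrow> complex" where
  "starlike_convex_mean lam f z =
     (1 - of_real lam) * (if z = 0 then 1 else z * deriv f z / f z) +
     of_real lam * (1 + z * deriv (deriv f) z / deriv f z)"

text \<open>
  The function \<open>g\<close> is determined on the unit disc by \<open>f\<close>, so quantifying it existentially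
  amounts to speaking of the inverse.
\<close>

definition H_Sigma :: "real \<Rightarrow> real \<Rightarrow> (complex \<Rightarrow> complex) set" where
  "H_Sigma lam t = {f \<in> bi_univalent_class. \<exists>g. bi_univalent_inverse f g \<and>
     starlike_convex_mean lam f \<prec>\<^sub>D chebyshev_gen t \<and>
     starlike_convex_mean lam g \<prec>\<^sub>D chebyshev_gen t}"

end

theory Submission imports Defs begin

text \<open>
  The bounds come from the coefficients of \<open>z\<close> and \<open>z\<^sup>2\<close> in the two subordinations. Write
  \<open>f(z) = z + a\<^sub>2 z\<^sup>2 + a\<^sub>3 z\<^sup>3 + \<dots>\<close> and let \<open>c z + d z\<^sup>2 + \<dots>\<close> be the Schwarz function of
  the subordination for \<open>f\<close>. Since \<open>1 / (1 - 2 t z + z\<^sup>2) = 1 + 2 t z + (4 t\<^sup>2 - 1) z\<^sup>2 + \<dots>\<close>,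
  comparing coefficients gives
  \<open>(1 + \<lambda>) a\<^sub>2 = 2 t c\<close> and
  \<open>2 (1 + 2 \<lambda>) a\<^sub>3 - (1 + 3 \<lambda>) a\<^sub>2\<^sup>2 = 2 t d + (4 t\<^sup>2 - 1) c\<^sup>2\<close>
  (lemma \<open>chebyshev_subordination_coefficients\<close>). The inverse of \<open>f\<close> starts with
  \<open>w - a\<^sub>2 w\<^sup>2 + (2 a\<^sub>2\<^sup>2 - a\<^sub>3) w\<^sup>3\<close>, so it satisfies the same two equations with
  \<open>-a\<^sub>2\<close>, \<open>2 a\<^sub>2\<^sup>2 - a\<^sub>3\<close> and the coefficients \<open>c'\<close>, \<open>d'\<close> of another Schwarz function.

  The first equations force \<open>c' = -c\<close>. Subtracting the second ones then eliminates \<open>c\<close> and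
  leaves \<open>a\<^sub>3 - a\<^sub>2\<^sup>2 = k (d - d')\<close> with \<open>k = t / (2 (1 + 2 \<lambda>))\<close>; adding them and
  replacing \<open>c\<close> by a multiple of \<open>a\<^sub>2\<close> gives \<open>\<Delta> a\<^sub>2\<^sup>2 = 4 t\<^sup>3 (d + d')\<close> with
  \<open>\<Delta> = 4 (1 + \<lambda>) t\<^sup>2 - (1 + \<lambda>)\<^sup>2 (4 t\<^sup>2 - 1)\<close>. Hence, for \<open>\<Delta> \<noteq> 0\<close>,
  \<open>a\<^sub>3 - \<mu> a\<^sub>2\<^sup>2 = (h + k) d + (h - k) d'\<close> with \<open>h = 4 (1 - \<mu>) t\<^sup>3 / \<Delta>\<close>. As \<open>d\<close> and \<open>d'\<close>
  have modulus at most 1, the left-hand side is bounded by \<open>|h + k| + |h - k| = 2 max(|h|, |k|)\<close>.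
  The threshold for \<open>|\<mu> - 1|\<close> is exactly where \<open>|h| = |k|\<close>, and the two alternatives of the
  theorem say which of the two numbers is the maximum. If \<open>\<Delta> = 0\<close>, the first alternative
  leaves only \<open>\<mu> = 1\<close>, where the formula for \<open>a\<^sub>3 - a\<^sub>2\<^sup>2\<close> suffices.
\<close>

section \<open>Coefficients of bounded functions\<close>

text \<open>
  Cauchy's inequality on the circle of radius \<open>r\<close> bounds the coefficient by \<open>1 / r ^ n\<close>; let
  \<open>r\<close> tend to 1.
\<close>

lemma norm_fps_nth_le_1_if_bounded_on_disc:
  assumes hol: "w holomorphic_on ball 0 1" and exp: "w has_fps_expansion W"
    and bound: "\<And>z. z \<in> ball 0 1 \<Longrightarrow> norm (w z) \<le> 1"
  shows "norm (fps_nth W n) \<le> 1"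
proof -
  have coeff: "(deriv ^^ n) w 0 = fact n * fps_nth W n"
    using fps_nth_fps_expansion[OF exp, of n] by simp
  have cauchy: "norm (fps_nth W n) * r ^ n \<le> 1" if r: "0 < r" "r < 1" for r :: real
  proof -
    have "norm ((deriv ^^ n) w 0) \<le> fact n * 1 / r ^ n"
    proof (rule Cauchy_inequality)
      show "w holomorphic_on ball 0 r"
        by (rule holomorphic_on_subset[OF hol]) (use r in auto)
      show "continuous_on (cball 0 r) w"
        by (rule holomorphic_on_imp_continuous_on, rule holomorphic_on_subset[OF hol]) (use r in auto)
    qed (use r bound in auto)
    thus ?thesis
      using r by (simp add: coeff norm_mult field_simps)
  qed
  have "((\<lambda>r::real. norm (fps_nth W n) * r ^ n) \<longlongrightarrow> norm (fps_nth W n) * 1 ^ n) (at_left 1)"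
    by (intro tendsto_intros)
  moreover have "eventually (\<lambda>r::real. norm (fps_nth W n) * r ^ n \<le> 1) (at_left 1)"
    using eventually_at_left_real[of 0 "1::real"] by (rule eventually_mono) (use cauchy in auto)
  ultimately show ?thesis
    using tendsto_upperbound[of _ _ "at_left (1::real)" 1] by simp
qed

section \<open>The coefficient relations from subordination\<close>

lemma eventually_nonzero_if_fps_nth_0_nonzero:
  fixes q :: "complex \<Rightarrow> complex"
  assumes "q has_fps_expansion Q" and "fps_nth Q 0 \<noteq> 0"
  shows "eventually (\<lambda>z. q z \<noteq> 0) (nhds 0)"
  using has_fps_expansion_imp_tendsto_0[OF assms(1)] assms(2) by (rule tendsto_imp_eventually_ne)

text \<open>
  Clearing denominators in the subordination identity yields
  \<open>f f' = (1 - 2 t \<omega> + \<omega>\<^sup>2) ((1 - \<lambda>) z f'\<^sup>2 + \<lambda> f (f' + z f''))\<close> near the origin. In this form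
  the removable singularity disappears and both sides are polynomial in power series, so that
  the relations are read off from the coefficients of \<open>z\<^sup>2\<close> and \<open>z\<^sup>3\<close>. The numbers \<open>c\<close> and
  \<open>d\<close> are the first two coefficients of the Schwarz function \<open>\<omega>\<close>.
\<close>

lemma chebyshev_subordination_coefficients:
  assumes f: "f has_fps_expansion F" and F: "fps_nth F 0 = 0" "fps_nth F 1 = 1"
    and sub: "starlike_convex_mean lam f \<prec>\<^sub>D chebyshev_gen t"
  obtains c d where "norm d \<le> 1"
    and "(1 + of_real lam) * fps_nth F 2 = 2 * of_real t * c"
    and "2 * (1 + 2 * of_real lam) * fps_nth F 3 - (1 + 3 * of_real lam) * (fps_nth F 2)\<^sup>2 =
           2 * of_real t * d + (4 * (of_real t)\<^sup>2 - 1) * c\<^sup>2"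
proof -
  define l s where "l = complex_of_real lam" and "s = complex_of_real t"
  obtain w where w: "w holomorphic_on ball 0 1" "w 0 = 0" "\<And>z. z \<in> ball 0 1 \<Longrightarrow> norm (w z) < 1"
    and eq: "\<And>z. z \<in> ball 0 1 \<Longrightarrow> starlike_convex_mean lam f z = chebyshev_gen t (w z)"
    using sub unfolding subordinate_def by blast
  define W where "W = fps_expansion w 0"
  have wW: "w has_fps_expansion W"
    unfolding W_def using w(1) by (intro has_fps_expansion_fps_expansion[of "ball 0 1"]) auto
  have W0: "fps_nth W 0 = 0"
    using has_fps_expansion_imp_0_eq_fps_nth_0[OF wW] w(2) by simp
  define M where "M = fps_const (1 - l) * (fps_X * fps_deriv F * fps_deriv F) +
    fps_const l * (F * (fps_deriv F + fps_X * fps_deriv (fps_deriv F)))"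
  define Q where "Q = 1 - fps_const (2 * s) * W + W * W"
  have q: "(\<lambda>z. 1 - (2 * s) * w z + w z * w z) has_fps_expansion Q"
    unfolding Q_def by (intro fps_expansion_intros wW)
  have m: "(\<lambda>z. (1 - l) * (z * deriv f z * deriv f z)
      + l * (f z * (deriv f z + z * deriv (deriv f) z))) has_fps_expansion M"
    unfolding M_def by (intro fps_expansion_intros f)
  have q0: "eventually (\<lambda>z. 1 - (2 * s) * w z + w z * w z \<noteq> 0) (nhds 0)"
    using eventually_nonzero_if_fps_nth_0_nonzero[OF q] W0 by (simp add: Q_def)
  have d0: "eventually (\<lambda>z. deriv f z \<noteq> 0) (nhds 0)"
    using eventually_nonzero_if_fps_nth_0_nonzero[OF has_fps_expansion_deriv[OF f]] F by simp
  \<comment> \<open>\<open>f\<close> has a simple zero at the origin, so \<open>f z / z\<close> extends to a function with value 1 there.\<close>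
  have "(\<lambda>z. if z = 0 then 1 else f z / z ^ 1) has_fps_expansion fps_shift 1 F"
  proof (rule has_fps_expansion_shift[OF f])
    show "1 \<le> subdegree F"
      using F by (intro subdegree_geI) auto
  qed (simp only: F)
  from eventually_nonzero_if_fps_nth_0_nonzero[OF this] F
  have f0: "eventually (\<lambda>z. z = 0 \<or> f z \<noteq> 0) (nhds 0)"
    by (auto elim!: eventually_mono split: if_splits)
  have "eventually (\<lambda>z. z \<in> ball 0 (1::real)) (nhds (0::complex))"
    by (intro eventually_nhds_in_open) auto
  with q0 d0 f0 have "eventually (\<lambda>z. f z * deriv f z = (1 - (2 * s) * w z + w z * w z) *
      ((1 - l) * (z * deriv f z * deriv f z) + l * (f z * (deriv f z + z * deriv (deriv f) z)))) (nhds 0)"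
  proof eventually_elim
    case (elim z)
    show ?case
    proof (cases "z = 0")
      case True
      then show ?thesis
        using has_fps_expansion_imp_0_eq_fps_nth_0[OF f] F by simp
    next
      case False
      let ?q = "1 - (2 * s) * w z + w z * w z"
      let ?m = "(1 - l) * (z * deriv f z * deriv f z)
        + l * (f z * (deriv f z + z * deriv (deriv f) z))"
      have "?m / (f z * deriv f z) = starlike_convex_mean lam f z"
        using False elim by (simp add: starlike_convex_mean_def l_def field_simps)
      also have "\<dots> = 1 / ?q"
        using eq elim by (simp add: chebyshev_gen_def s_def power2_eq_square)
      finally show ?thesis
        using False elim by (simp add: field_simps)
    qed
  qed
  from has_fps_expansion_cong[OF this refl] has_fps_expansion_mult[OF f has_fps_expansion_deriv[OF f]]
  have "(\<lambda>z. (1 - (2 * s) * w z + w z * w z) * ((1 - l) * (z * deriv f z * deriv f z) +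
      l * (f z * (deriv f z + z * deriv (deriv f) z)))) has_fps_expansion F * fps_deriv F"
    by blast
  from fps_expansion_unique_complex[OF this has_fps_expansion_mult[OF q m]]
  have series_eq: "F * fps_deriv F = Q * M" .
  have F': "fps_nth F (Suc 0) = 1" using F by simp
  have M: "fps_nth M 0 = 0" "fps_nth M 1 = 1" "fps_nth M 2 = (4 + l) * fps_nth F 2"
    "fps_nth M 3 = 4 * (fps_nth F 2)\<^sup>2 + (6 + 4 * l) * fps_nth F 3"
    by (simp_all add: M_def fps_mult_nth F F' mult.assoc numeral_2_eq_2 numeral_3_eq_3
        power2_eq_square algebra_simps)
  have Q: "fps_nth Q 0 = 1" "fps_nth Q 1 = - 2 * s * fps_nth W 1"
    "fps_nth Q 2 = (fps_nth W 1)\<^sup>2 - 2 * s * fps_nth W 2"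
    by (simp_all add: Q_def fps_mult_nth W0 numeral_2_eq_2 power2_eq_square)
  have "fps_nth (F * fps_deriv F) 2 = 3 * fps_nth F 2"
    by (simp add: fps_mult_nth F F' numeral_2_eq_2)
  moreover have "fps_nth (Q * M) 2 = fps_nth M 2 + fps_nth Q 1"
    using M Q by (simp add: fps_mult_nth numeral_2_eq_2)
  ultimately have first: "(1 + l) * fps_nth F 2 = 2 * s * fps_nth W 1"
    using series_eq M Q by (simp add: algebra_simps)
  have "fps_nth (F * fps_deriv F) 3 = 4 * fps_nth F 3 + 2 * (fps_nth F 2)\<^sup>2"
    by (simp add: fps_mult_nth F F' numeral_2_eq_2 numeral_3_eq_3 power2_eq_square)
  moreover have "fps_nth (Q * M) 3 = fps_nth M 3 + fps_nth Q 1 * fps_nth M 2 + fps_nth Q 2"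
    using M Q by (simp add: fps_mult_nth numeral_2_eq_2 numeral_3_eq_3)
  ultimately have "4 * fps_nth F 3 + 2 * (fps_nth F 2)\<^sup>2 =
      4 * (fps_nth F 2)\<^sup>2 + (6 + 4 * l) * fps_nth F 3
      - 2 * s * fps_nth W 1 * ((4 + l) * fps_nth F 2) + ((fps_nth W 1)\<^sup>2 - 2 * s * fps_nth W 2)"
    using series_eq M Q by simp
  \<comment> \<open>The first relation turns the mixed term into a multiple of \<open>a\<^sub>2\<^sup>2\<close>; its square, added to
    both sides, then produces the coefficient \<open>4 t\<^sup>2 - 1\<close> of the Chebyshev series.\<close>
  with first have second: "2 * (1 + 2 * l) * fps_nth F 3 - (1 + 3 * l) * (fps_nth F 2)\<^sup>2 =
      2 * s * fps_nth W 2 + (4 * s\<^sup>2 - 1) * (fps_nth W 1)\<^sup>2"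
    by algebra
  have "norm (fps_nth W 2) \<le> 1"
    by (rule norm_fps_nth_le_1_if_bounded_on_disc[OF w(1) wW]) (use w(3) in \<open>auto intro: less_imp_le\<close>)
  from that[OF this first[unfolded l_def s_def] second[unfolded l_def s_def]] show ?thesis .
qed

section \<open>Taylor series of a normalized function and of its inverse\<close>

lemma inverse_fps_coefficients:
  fixes F G :: "complex fps"
  assumes comp: "F oo G = fps_X" and F: "fps_nth F 0 = 0" "fps_nth F 1 = 1" and G: "fps_nth G 0 = 0"
  shows "fps_nth G 1 = 1" "fps_nth G 2 = - fps_nth F 2"
    "fps_nth G 3 = 2 * (fps_nth F 2)\<^sup>2 - fps_nth F 3"
proof -
  have F': "fps_nth F (Suc 0) = 1" using F by simp
  have G1: "fps_nth G (Suc 0) = 1"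
    using arg_cong[OF comp, of "\<lambda>A. fps_nth A 1"] by (simp add: fps_compose_nth F F' G)
  thus "fps_nth G 1 = 1" by simp
  show G2: "fps_nth G 2 = - fps_nth F 2"
    using arg_cong[OF comp, of "\<lambda>A. fps_nth A 2"]
    by (simp add: fps_compose_nth fps_mult_nth F F' G G1 numeral_2_eq_2 eq_neg_iff_add_eq_0)
  show "fps_nth G 3 = 2 * (fps_nth F 2)\<^sup>2 - fps_nth F 3"
    using arg_cong[OF comp, of "\<lambda>A. fps_nth A 3"] G2
    by (simp add: fps_compose_nth fps_mult_nth F F' G G1 numeral_2_eq_2 numeral_3_eq_3
        power2_eq_square) (simp add: algebra_simps eq_diff_eq add_eq_0_iff)
qed

text \<open>
  The continuation agrees with the local inverse of \<open>f\<close> near the origin, which determines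
  its Taylor series there as the compositional inverse of that of \<open>f\<close>.
\<close>

lemma bi_univalent_inverse_fps:
  assumes f: "f has_fps_expansion F" "f 0 = 0" and inv: "bi_univalent_inverse f g"
  obtains G where "g has_fps_expansion G" "fps_nth G 0 = 0" "F oo G = fps_X"
proof -
  from inv obtain r where inj: "inj_on f (ball 0 1)" and g: "g holomorphic_on ball 0 1"
    and r: "r > 0" "ball 0 r \<subseteq> f ` ball 0 1"
    and ginv: "\<And>w. w \<in> ball 0 r \<Longrightarrow> g w = inv_into (ball 0 1) f w"
    unfolding bi_univalent_inverse_def inverse_continuation_def by blast
  define G where "G = fps_expansion g 0"
  have gG: "g has_fps_expansion G"
    unfolding G_def using g by (intro has_fps_expansion_fps_expansion[of "ball 0 1"]) auto
  have "g 0 = 0"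
    using ginv[of 0] r inv_into_f_f[OF inj, of 0] f(2) by simp
  then have G0: "fps_nth G 0 = 0"
    using has_fps_expansion_imp_0_eq_fps_nth_0[OF gG] by simp
  have "eventually (\<lambda>w. w \<in> ball 0 r) (nhds (0::complex))"
    using r by (intro eventually_nhds_in_open) auto
  then have "eventually (\<lambda>w. (f \<circ> g) w = w) (nhds 0)"
    by (rule eventually_mono) (use r ginv in \<open>auto intro!: f_inv_into_f\<close>)
  from has_fps_expansion_cong[OF this refl] has_fps_expansion_compose[OF f(1) gG G0]
  have "(\<lambda>w. w) has_fps_expansion (F oo G)" by (simp add: comp_def)
  from fps_expansion_unique_complex[OF this has_fps_expansion_fps_X]
  show ?thesis using that gG G0 by blast
qed

lemma has_fps_expansion_normalized_series:
  fixes f :: "complex \<Rightarrow> complex" and a :: "nat \<Rightarrow> complex"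
  assumes "\<And>z. z \<in> ball 0 1 \<Longrightarrow> (\<lambda>n. a (n + 2) * z ^ (n + 2)) sums (f z - z)"
  shows "f has_fps_expansion Abs_fps (\<lambda>n. if n = 0 then 0 else if n = 1 then 1 else a n)"
    (is "_ has_fps_expansion ?A")
proof (rule has_fps_expansionI)
  have "eventually (\<lambda>z. z \<in> ball 0 (1::real)) (nhds (0::complex))"
    by (intro eventually_nhds_in_open) auto
  then show "eventually (\<lambda>z. (\<lambda>n. fps_nth ?A n * z ^ n) sums f z) (nhds 0)"
  proof (rule eventually_mono)
    fix z :: complex
    assume "z \<in> ball 0 1"
    from assms[OF this] have "(\<lambda>n. fps_nth ?A (n + 2) * z ^ (n + 2)) sums (f z - z)"
      by simp
    then show "(\<lambda>n. fps_nth ?A n * z ^ n) sums f z"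
      by (subst (asm) sums_iff_shift) (simp add: numeral_2_eq_2)
  qed
qed

section \<open>The Fekete--Szego bound\<close>

lemma norm_combination_le_twice_max:
  fixes c d :: complex and h k :: real
  assumes "norm c \<le> 1" "norm d \<le> 1"
  shows "norm (of_real (h + k) * c + of_real (h - k) * d) \<le> 2 * max \<bar>h\<bar> \<bar>k\<bar>"
proof -
  have "norm (of_real (h + k) * c + of_real (h - k) * d) \<le> \<bar>h + k\<bar> * norm c + \<bar>h - k\<bar> * norm d"
    by (rule norm_triangle_le) (simp only: norm_mult norm_of_real order_refl)
  also have "\<dots> \<le> \<bar>h + k\<bar> * 1 + \<bar>h - k\<bar> * 1"
    using assms by (intro add_mono mult_left_mono) auto
  also have "\<dots> = 2 * max \<bar>h\<bar> \<bar>k\<bar>"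
    by (simp add: max_def abs_if)
  finally show ?thesis .
qed

text \<open>
  This is the purely algebraic part: the four coefficient relations are solved for \<open>a\<^sub>3 - a\<^sub>2\<^sup>2\<close>
  and \<open>\<Delta> a\<^sub>2\<^sup>2\<close> in terms of \<open>d\<close> and \<open>d'\<close>. The case \<open>\<mu> = 1\<close> is kept apart because it
  also covers \<open>\<Delta> = 0\<close>, when \<open>a\<^sub>2\<^sup>2\<close> cannot be recovered from \<open>d + d'\<close>.
\<close>

lemma fekete_szego_of_coefficient_relations:
  fixes a2 a3 c c' d d' :: complex and lam t \<mu> :: real
  defines "\<Delta> \<equiv> 4 * (1 + lam) * t\<^sup>2 - (1 + lam)\<^sup>2 * (4 * t\<^sup>2 - 1)"
  assumes lam: "lam \<ge> 0" and t: "t > 0" and d: "norm d \<le> 1" "norm d' \<le> 1"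
    and f1: "(1 + of_real lam) * a2 = 2 * of_real t * c"
    and f2: "2 * (1 + 2 * of_real lam) * a3 - (1 + 3 * of_real lam) * a2\<^sup>2 =
           2 * of_real t * d + (4 * (of_real t)\<^sup>2 - 1) * c\<^sup>2"
    and g1: "(1 + of_real lam) * (- a2) = 2 * of_real t * c'"
    and g2: "2 * (1 + 2 * of_real lam) * (2 * a2\<^sup>2 - a3) - (1 + 3 * of_real lam) * (- a2)\<^sup>2 =
           2 * of_real t * d' + (4 * (of_real t)\<^sup>2 - 1) * c'\<^sup>2"
  shows "\<mu> = 1 \<Longrightarrow> norm (a3 - of_real \<mu> * a2\<^sup>2) \<le> t / (1 + 2 * lam)"
    and "\<Delta> \<noteq> 0 \<Longrightarrow> norm (a3 - of_real \<mu> * a2\<^sup>2) \<le>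
      2 * max \<bar>4 * (1 - \<mu>) * t ^ 3 / \<Delta>\<bar> \<bar>t / (2 * (1 + 2 * lam))\<bar>"
proof -
  define k where "k = t / (2 * (1 + 2 * lam))"
  have k: "2 * (1 + 2 * complex_of_real lam) * of_real k = of_real t"
  proof -
    have "2 * (1 + 2 * lam) * k = t" using lam by (simp add: k_def field_simps)
    from arg_cong[OF this, of complex_of_real] show ?thesis by simp
  qed
  have nz: "1 + 2 * complex_of_real lam \<noteq> 0"
  proof -
    have "complex_of_real (1 + 2 * lam) \<noteq> 0" using lam by (simp only: of_real_eq_0_iff)
    then show ?thesis by simp
  qed
  have tnz: "complex_of_real t \<noteq> 0" using t by simp
  have "2 * complex_of_real t * (c' + c) = 0" using f1 g1 by algebra
  then have c': "c' = - c" using tnz by (simp add: eq_neg_iff_add_eq_0)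
  have "4 * (1 + 2 * complex_of_real lam) * (a3 - a2\<^sup>2) = 2 * of_real t * (d - d')"
    using f2 g2 unfolding c' by algebra
  then have "4 * (1 + 2 * complex_of_real lam) * (a3 - a2\<^sup>2 - of_real k * (d - d')) = 0"
    using k by algebra
  then have "a3 - a2\<^sup>2 - of_real k * (d - d') = 0"
    using nz by (simp only: mult_eq_0_iff) simp
  then have diff: "a3 = a2\<^sup>2 + of_real k * (d - d')" by (simp add: algebra_simps)
  have sum: "of_real \<Delta> * a2\<^sup>2 = of_real (4 * t ^ 3) * (d + d')"
  proof -
    have "2 * (1 + complex_of_real lam) * a2\<^sup>2 =
        2 * of_real t * (d + d') + 2 * (4 * (of_real t)\<^sup>2 - 1) * c\<^sup>2"
      using f2 g2 unfolding c' by algebra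
    with f1 have "(4 * (1 + of_real lam) * (of_real t)\<^sup>2 - (1 + of_real lam)\<^sup>2 * (4 * (of_real t)\<^sup>2 - 1)) * a2\<^sup>2
        = (4 * of_real t ^ 3) * (d + d')"
      by algebra
    then show ?thesis by (simp add: \<Delta>_def)
  qed
  show "norm (a3 - of_real \<mu> * a2\<^sup>2) \<le> t / (1 + 2 * lam)" if "\<mu> = 1"
  proof -
    have "a3 - of_real \<mu> * a2\<^sup>2 = of_real (0 + k) * d + of_real (0 - k) * d'"
      using that diff by (simp add: algebra_simps)
    also have "norm \<dots> \<le> 2 * max \<bar>0\<bar> \<bar>k\<bar>" by (rule norm_combination_le_twice_max[OF d])
    also have "\<dots> = 2 * k" using lam t by (simp add: k_def)
    also have "\<dots> = t / (1 + 2 * lam)" using lam by (simp add: k_def field_simps)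
    finally show ?thesis .
  qed
  show "norm (a3 - of_real \<mu> * a2\<^sup>2) \<le>
      2 * max \<bar>4 * (1 - \<mu>) * t ^ 3 / \<Delta>\<bar> \<bar>t / (2 * (1 + 2 * lam))\<bar>" if "\<Delta> \<noteq> 0"
  proof -
    define h where "h = 4 * (1 - \<mu>) * t ^ 3 / \<Delta>"
    have "a2\<^sup>2 = of_real (4 * t ^ 3) * (d + d') / of_real \<Delta>"
      using sum that by (simp add: field_simps)
    then have "of_real (1 - \<mu>) * a2\<^sup>2 = of_real h * (d + d')"
      by (simp add: h_def algebra_simps)
    with diff have "a3 - of_real \<mu> * a2\<^sup>2 = of_real (h + k) * d + of_real (h - k) * d'"
      by (simp add: algebra_simps)
    then show ?thesis
      using norm_combination_le_twice_max[OF d, of h k] by (simp add: h_def k_def)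
  qed
qed

theorem theorem3:
  fixes lam t \<mu> :: real and f :: "complex \<Rightarrow> complex" and a :: "nat \<Rightarrow> complex"
  assumes "lam \<ge> 0" and "t \<in> {sqrt 2 / 2<..1}"
    and "f \<in> H_Sigma lam t"
    and "\<And>z. z \<in> ball 0 1 \<Longrightarrow> (\<lambda>n. a (n + 2) * z ^ (n + 2)) sums (f z - z)"
  shows "(\<bar>\<mu> - 1\<bar> \<le> 1 / (8 * (1 + 2 * lam)) * \<bar>(1 + lam)\<^sup>2 / t\<^sup>2 - 4 * lam * (1 + lam)\<bar> \<longrightarrow>
            norm (a 3 - of_real \<mu> * (a 2)\<^sup>2) \<le> t / (1 + 2 * lam)) \<and>
         (\<bar>\<mu> - 1\<bar> \<ge> 1 / (8 * (1 + 2 * lam)) * \<bar>(1 + lam)\<^sup>2 / t\<^sup>2 - 4 * lam * (1 + lam)\<bar> \<longrightarrow>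
            4 * (1 + lam) * t\<^sup>2 - (1 + lam)\<^sup>2 * (4 * t\<^sup>2 - 1) \<noteq> 0 \<longrightarrow>
            norm (a 3 - of_real \<mu> * (a 2)\<^sup>2) \<le>
              8 * \<bar>1 - \<mu>\<bar> * t ^ 3 / \<bar>4 * (1 + lam) * t\<^sup>2 - (1 + lam)\<^sup>2 * (4 * t\<^sup>2 - 1)\<bar>)"
proof -
  have lam: "lam \<ge> 0" and t: "t > 0"
    using assms(1,2) by (auto intro: less_trans[of 0 "sqrt 2 / 2"])
  from assms(3) obtain g where inv: "bi_univalent_inverse f g" and "f 0 = 0"
    and subf: "starlike_convex_mean lam f \<prec>\<^sub>D chebyshev_gen t"
    and subg: "starlike_convex_mean lam g \<prec>\<^sub>D chebyshev_gen t"
    unfolding H_Sigma_def bi_univalent_class_def normalized_class_def by blast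
  define F where "F = Abs_fps (\<lambda>n. if n = 0 then 0 else if n = 1 then 1 else a n)"
  have fF: "f has_fps_expansion F"
    unfolding F_def by (rule has_fps_expansion_normalized_series[OF assms(4)])
  have F: "fps_nth F 0 = 0" "fps_nth F 1 = 1" "fps_nth F 2 = a 2" "fps_nth F 3 = a 3"
    by (simp_all add: F_def)
  obtain G where gG: "g has_fps_expansion G" and G0: "fps_nth G 0 = 0" and comp: "F oo G = fps_X"
    using bi_univalent_inverse_fps[OF fF \<open>f 0 = 0\<close> inv] .
  note G = inverse_fps_coefficients[OF comp F(1,2) G0]
  obtain c d where cd: "norm d \<le> 1" "(1 + of_real lam) * a 2 = 2 * of_real t * c"
    "2 * (1 + 2 * of_real lam) * a 3 - (1 + 3 * of_real lam) * (a 2)\<^sup>2 =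
       2 * of_real t * d + (4 * (of_real t)\<^sup>2 - 1) * c\<^sup>2"
    using chebyshev_subordination_coefficients[OF fF F(1,2) subf] unfolding F by blast
  obtain c' d' where cd': "norm d' \<le> 1" "(1 + of_real lam) * (- a 2) = 2 * of_real t * c'"
    "2 * (1 + 2 * of_real lam) * (2 * (a 2)\<^sup>2 - a 3) - (1 + 3 * of_real lam) * (- a 2)\<^sup>2 =
       2 * of_real t * d' + (4 * (of_real t)\<^sup>2 - 1) * c'\<^sup>2"
    using chebyshev_subordination_coefficients[OF gG G0 G(1) subg] unfolding G F by blast
  note bounds = fekete_szego_of_coefficient_relations[OF lam t cd(1) cd'(1) cd(2,3) cd'(2,3), of \<mu>]
  define \<Delta> where "\<Delta> = 4 * (1 + lam) * t\<^sup>2 - (1 + lam)\<^sup>2 * (4 * t\<^sup>2 - 1)"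
  let ?h = "4 * (1 - \<mu>) * t ^ 3 / \<Delta>" and ?k = "t / (2 * (1 + 2 * lam))"
  have "(1 + lam)\<^sup>2 / t\<^sup>2 - 4 * lam * (1 + lam) = \<Delta> / t\<^sup>2"
    using t by (simp add: \<Delta>_def field_simps power2_eq_square)
  then have thr: "1 / (8 * (1 + 2 * lam)) * \<bar>(1 + lam)\<^sup>2 / t\<^sup>2 - 4 * lam * (1 + lam)\<bar> =
      \<bar>\<Delta>\<bar> / (8 * (1 + 2 * lam) * t\<^sup>2)"
    by (simp add: abs_divide)
  have abs_h: "\<bar>?h\<bar> = 4 * \<bar>\<mu> - 1\<bar> * t ^ 3 / \<bar>\<Delta>\<bar>"
    using t by (simp add: abs_mult abs_minus_commute del: right_diff_distrib_numeral)
  have abs_k: "\<bar>?k\<bar> = ?k" using lam t by simp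
  \<comment> \<open>Both \<open>|h|\<close> and \<open>|k|\<close> are \<open>4 t\<^sup>3 / |\<Delta>|\<close> times one side of the condition on \<open>\<mu>\<close>.\<close>
  have le: "\<bar>?h\<bar> \<le> \<bar>?k\<bar> \<longleftrightarrow> \<bar>\<mu> - 1\<bar> \<le> \<bar>\<Delta>\<bar> / (8 * (1 + 2 * lam) * t\<^sup>2)"
    and ge: "\<bar>?h\<bar> \<ge> \<bar>?k\<bar> \<longleftrightarrow> \<bar>\<mu> - 1\<bar> \<ge> \<bar>\<Delta>\<bar> / (8 * (1 + 2 * lam) * t\<^sup>2)" if "\<Delta> \<noteq> 0"
  proof -
    have "\<bar>?h\<bar> = \<bar>\<mu> - 1\<bar> * (4 * t ^ 3 / \<bar>\<Delta>\<bar>)"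
      unfolding abs_h by simp
    moreover have "\<bar>?k\<bar> = \<bar>\<Delta>\<bar> / (8 * (1 + 2 * lam) * t\<^sup>2) * (4 * t ^ 3 / \<bar>\<Delta>\<bar>)"
    proof -
      have "t / (2 * m) = \<bar>\<Delta>\<bar> / (8 * m * t\<^sup>2) * (4 * t ^ 3 / \<bar>\<Delta>\<bar>)" if "m > 0" for m :: real
        using that \<open>\<Delta> \<noteq> 0\<close> t by (simp add: field_simps power2_eq_square power3_eq_cube)
      from this[of "1 + 2 * lam"] show ?thesis unfolding abs_k using lam by linarith
    qed
    moreover have "4 * t ^ 3 / \<bar>\<Delta>\<bar> > 0" using that t by simp
    ultimately show "\<bar>?h\<bar> \<le> \<bar>?k\<bar> \<longleftrightarrow> \<bar>\<mu> - 1\<bar> \<le> \<bar>\<Delta>\<bar> / (8 * (1 + 2 * lam) * t\<^sup>2)"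
      and "\<bar>?h\<bar> \<ge> \<bar>?k\<bar> \<longleftrightarrow> \<bar>\<mu> - 1\<bar> \<ge> \<bar>\<Delta>\<bar> / (8 * (1 + 2 * lam) * t\<^sup>2)"
      by (simp_all only: mult_le_cancel_right_pos)
  qed
  show ?thesis
    unfolding thr \<Delta>_def[symmetric]
  proof (intro conjI impI)
    assume small: "\<bar>\<mu> - 1\<bar> \<le> \<bar>\<Delta>\<bar> / (8 * (1 + 2 * lam) * t\<^sup>2)"
    show "norm (a 3 - of_real \<mu> * (a 2)\<^sup>2) \<le> t / (1 + 2 * lam)"
    proof (cases "\<Delta> = 0")
      case True
      with small show ?thesis by (intro bounds(1)) simp
    next
      case False
      have "max \<bar>?h\<bar> \<bar>?k\<bar> = ?k"
        using le[OF False] small abs_k by (simp only: max.absorb2)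
      moreover have "2 * ?k = t / (1 + 2 * lam)" using lam by (simp add: field_simps)
      ultimately show ?thesis
        using bounds(2)[folded \<Delta>_def, OF False] by (simp only:)
    qed
  next
    assume large: "\<bar>\<mu> - 1\<bar> \<ge> \<bar>\<Delta>\<bar> / (8 * (1 + 2 * lam) * t\<^sup>2)" and nz: "\<Delta> \<noteq> 0"
    have "max \<bar>?h\<bar> \<bar>?k\<bar> = \<bar>?h\<bar>"
      using ge[OF nz] large by (simp only: max.absorb1)
    with bounds(2)[folded \<Delta>_def, OF nz]
    have "norm (a 3 - of_real \<mu> * (a 2)\<^sup>2) \<le> 2 * \<bar>?h\<bar>" by (simp only:)
    also have "\<dots> = 8 * \<bar>1 - \<mu>\<bar> * t ^ 3 / \<bar>\<Delta>\<bar>"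
      unfolding abs_h by (simp add: abs_minus_commute)
    finally show "norm (a 3 - of_real \<mu> * (a 2)\<^sup>2) \<le> 8 * \<bar>1 - \<mu>\<bar> * t ^ 3 / \<bar>\<Delta>\<bar>" .
  qed
qed

end
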